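(* Let $\mathcal{F}$ be a family of finite posets that is closed under taking order ideals and order filters (i.e. if $P\in\mathcal{F}$ and $I\subseteq P$ is an ideal or a filter of $P$, then the induced subposet $I$ belongs to $\mathcal{F}$), and such that for every $P\in\mathcal{F}$ the coefficient of the linear term of the order polynomial $\Omega_P(n)$ is nonnegative. Let $P\in\mathcal{F}$ and let $A\subseteq P$ be a subset (with the induced order) containing $\min(P)\cup\max(P)$, and let $A=\{a_0,\ldots,a_r\}$ be a natural labeling of $A$. Then there is a polynomial $f\in\mathbb{Q}[t_1,\ldots,t_r]$ with nonnegative coefficients such that \[\Omega_{P,A}(\lambda)=f(t_1,\ldots,t_r)\] for all $\lambda\colon A\to\mathbb{Z}$ with $\lambda(a_0)\le\lambda(a_1)\le\cdots\le\lambda(a_r)$, where $t_i=\lambda(a_i)-\lambda(a_{i-1})$ for $i=1,\ldots,r$.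
   Context: For a finite poset $P$ and a positive integer $n$, a map $g\colon P\to[n]=\{1,\ldots,n\}$ is order preserving if $g(p)\le g(q)$ whenever $p\prec_P q$. The number of such maps is given by a polynomial $\Omega_P(n)$ in $n$, the order polynomial of $P$. A subset $I\subseteq P$ is an (order) ideal if it is downward closed, and a filter if it is upward closed. $\min(P)$ and $\max(P)$ denote the sets of minimal and maximal elements of $P$. A natural labeling of $A=\{a_0,\ldots,a_r\}$ is one with $i<j$ whenever $a_i\prec_P a_j$. For $A\subseteq P$ and an order preserving $\lambda\colon A\to\mathbb{Z}$, the marked order polytope is $\mathcal{O}_{P,A}(\lambda)=\{\hat\lambda\colon P\to\mathbb{R}\text{ order preserving with }\hat\lambda(a)=\lambda(a)\text{ for all }a\in A\}\subset\mathbb{R}^P$, and $\Omega_{P,A}(\lambda)=|\mathcal{O}_{P,A}(\lambda)\cap\mathbb{Z}^P|$ is the number of integer-valued order preserving extensions of $\lambda$ from $A$ to $P$. *)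

theory Defs
  imports
    Complex_Main
    "HOL-Library.FuncSet"
    "HOL-Library.Infinite_Set"
    "HOL-Library.Poly_Mapping"
    "HOL-Computational_Algebra.Polynomial"
begin

section \<open>Finite posets\<close>

text \<open>
  A poset is given by its reflexive order relation \<open>P\<close>; its ground set is \<open>Field P\<close>, and the
  subposet induced on \<open>I \<subseteq> Field P\<close> is \<open>Restr P I\<close>.
\<close>

definition finite_poset :: "'a rel \<Rightarrow> bool" where
  "finite_poset P \<longleftrightarrow> finite (Field P) \<and> Partial_order P"

definition order_ideal :: "'a rel \<Rightarrow> 'a set \<Rightarrow> bool" where
  "order_ideal P I \<longleftrightarrow> I \<subseteq> Field P \<and> (\<forall>q\<in>I. \<forall>p. (p, q) \<in> P \<longrightarrow> p \<in> I)"

definition order_filter :: "'a rel \<Rightarrow> 'a set \<Rightarrow> bool" where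
  "order_filter P I \<longleftrightarrow> I \<subseteq> Field P \<and> (\<forall>p\<in>I. \<forall>q. (p, q) \<in> P \<longrightarrow> q \<in> I)"

definition min_elems :: "'a rel \<Rightarrow> 'a set" where
  "min_elems P = {p \<in> Field P. \<forall>q. (q, p) \<in> P \<longrightarrow> q = p}"

definition max_elems :: "'a rel \<Rightarrow> 'a set" where
  "max_elems P = {p \<in> Field P. \<forall>q. (p, q) \<in> P \<longrightarrow> q = p}"

abbreviation order_preserving :: "'a rel \<Rightarrow> ('a \<Rightarrow> 'b::linorder) \<Rightarrow> bool" where
  "order_preserving P g \<equiv> monotone_on (Field P) (\<lambda>p q. (p, q) \<in> P) (\<le>) g"

definition natural_labeling :: "'a rel \<Rightarrow> 'a set \<Rightarrow> nat \<Rightarrow> (nat \<Rightarrow> 'a) \<Rightarrow> bool" where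
  "natural_labeling P A r a \<longleftrightarrow>
     bij_betw a {0..r} A \<and>
     (\<forall>i\<in>{0..r}. \<forall>j\<in>{0..r}. (a i, a j) \<in> P \<and> a i \<noteq> a j \<longrightarrow> i < j)"


section \<open>The order polynomial\<close>

definition order_maps :: "'a rel \<Rightarrow> nat \<Rightarrow> ('a \<Rightarrow> nat) set" where
  "order_maps P n = {g \<in> Field P \<rightarrow>\<^sub>E {1..n}. order_preserving P g}"

text \<open>Existence and uniqueness are shown in \<open>ex1_order_poly\<close> below.\<close>

definition order_poly :: "'a rel \<Rightarrow> rat poly" where
  "order_poly P =
     (THE p. \<forall>n\<ge>1. poly p (of_nat n) = of_nat (card (order_maps P n)))"


section \<open>Marked order polytopes\<close>

text \<open>
  Points of \<open>\<real>\<^sup>P\<close> are functions that are \<open>undefined\<close> outside \<open>Field P\<close>, so that each of them is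
  counted once. Only the values of \<open>lam\<close> on \<open>A\<close> matter.
\<close>

definition marked_order_polytope :: "'a rel \<Rightarrow> 'a set \<Rightarrow> ('a \<Rightarrow> int) \<Rightarrow> ('a \<Rightarrow> real) set" where
  "marked_order_polytope P A lam =
     {h \<in> Field P \<rightarrow>\<^sub>E UNIV. order_preserving P h \<and> (\<forall>a\<in>A. h a = of_int (lam a))}"

definition marked_order_count :: "'a rel \<Rightarrow> 'a set \<Rightarrow> ('a \<Rightarrow> int) \<Rightarrow> nat" where
  "marked_order_count P A lam =
     card (marked_order_polytope P A lam \<inter> (Field P \<rightarrow>\<^sub>E \<int>))"


section \<open>Multivariate polynomials\<close>

text \<open>
  A polynomial over \<open>\<rat>\<close> in variables indexed by natural numbers is a finitely supported map from
  exponent vectors to coefficients.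
\<close>

type_synonym ratpoly = "(nat \<Rightarrow>\<^sub>0 nat) \<Rightarrow>\<^sub>0 rat"

definition variables :: "ratpoly \<Rightarrow> nat set" where
  "variables f = (\<Union>m\<in>Poly_Mapping.keys f. Poly_Mapping.keys m)"

definition eval_ratpoly :: "ratpoly \<Rightarrow> (nat \<Rightarrow> rat) \<Rightarrow> rat" where
  "eval_ratpoly f t =
     (\<Sum>m\<in>Poly_Mapping.keys f.
        Poly_Mapping.lookup f m *
        (\<Prod>i\<in>Poly_Mapping.keys m. t i ^ Poly_Mapping.lookup m i))"


section \<open>Well-definedness of the order polynomial and of the count\<close>

lemma card_monotone_maps_onto:
  fixes V :: "'a set" and R :: "'a \<Rightarrow> 'a \<Rightarrow> bool" and S :: "nat set"
  assumes "finite S"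
  shows "card {g \<in> V \<rightarrow>\<^sub>E S. monotone_on V R (\<le>) g \<and> g ` V = S} =
         card {g \<in> V \<rightarrow>\<^sub>E {..<card S}. monotone_on V R (\<le>) g \<and> g ` V = {..<card S}}"
proof -
  obtain h where h: "bij_betw h {..<card S} S" "strict_mono_on {..<card S} h"
    using ex_bij_betw_strict_mono_card[OF assms] by blast
  define k where "k = inv_into {..<card S} h"
  have hS: "h ` {..<card S} = S" and kS: "k ` S = {..<card S}"
    using h(1) bij_betw_inv_into[OF h(1)] by (auto simp: bij_betw_def k_def)
  have hk: "h (k x) = x" if "x \<in> S" for x
    using that h(1) by (simp add: k_def bij_betw_inv_into_right)
  have kh: "k (h x) = x" if "x < card S" for x
    using that h(1) by (simp add: k_def bij_betw_inv_into_left)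
  have hmono: "h x \<le> h y" if "x \<le> y" "x < card S" "y < card S" for x y
    using strict_mono_onD[OF h(2), of x y] that by (cases "x = y") auto
  have kmono: "k x \<le> k y" if "x \<le> y" "x \<in> S" "y \<in> S" for x y
  proof (rule ccontr)
    assume "\<not> k x \<le> k y"
    moreover have "k x \<in> {..<card S}" "k y \<in> {..<card S}" using kS that by auto
    ultimately have "h (k y) < h (k x)" using strict_mono_onD[OF h(2)] by auto
    then show False using hk that by auto
  qed
  have "bij_betw (\<lambda>g. restrict (h \<circ> g) V)
      {g \<in> V \<rightarrow>\<^sub>E {..<card S}. monotone_on V R (\<le>) g \<and> g ` V = {..<card S}}
      {g \<in> V \<rightarrow>\<^sub>E S. monotone_on V R (\<le>) g \<and> g ` V = S}"
  proof (rule bij_betwI[where g = "\<lambda>g. restrict (k \<circ> g) V"])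
    show "(\<lambda>g. restrict (h \<circ> g) V) \<in>
        {g \<in> V \<rightarrow>\<^sub>E {..<card S}. monotone_on V R (\<le>) g \<and> g ` V = {..<card S}} \<rightarrow>
        {g \<in> V \<rightarrow>\<^sub>E S. monotone_on V R (\<le>) g \<and> g ` V = S}"
    proof (rule funcsetI)
      fix g assume "g \<in> {g \<in> V \<rightarrow>\<^sub>E {..<card S}. monotone_on V R (\<le>) g \<and> g ` V = {..<card S}}"
      then have g: "g \<in> V \<rightarrow>\<^sub>E {..<card S}" "monotone_on V R (\<le>) g" "g ` V = {..<card S}" by auto
      have im: "restrict (h \<circ> g) V ` V = S" using g(3) hS by (metis image_comp image_restrict_eq)
      moreover have "restrict (h \<circ> g) V \<in> V \<rightarrow>\<^sub>E S" using im by auto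
      moreover have "monotone_on V R (\<le>) (restrict (h \<circ> g) V)"
        using g(1,2) hmono by (fastforce simp: monotone_on_def PiE_iff)
      ultimately show "restrict (h \<circ> g) V \<in> {g \<in> V \<rightarrow>\<^sub>E S. monotone_on V R (\<le>) g \<and> g ` V = S}"
        by blast
    qed
    show "(\<lambda>g. restrict (k \<circ> g) V) \<in>
        {g \<in> V \<rightarrow>\<^sub>E S. monotone_on V R (\<le>) g \<and> g ` V = S} \<rightarrow>
        {g \<in> V \<rightarrow>\<^sub>E {..<card S}. monotone_on V R (\<le>) g \<and> g ` V = {..<card S}}"
    proof (rule funcsetI)
      fix g assume "g \<in> {g \<in> V \<rightarrow>\<^sub>E S. monotone_on V R (\<le>) g \<and> g ` V = S}"
      then have g: "g \<in> V \<rightarrow>\<^sub>E S" "monotone_on V R (\<le>) g" "g ` V = S" by auto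
      have im: "restrict (k \<circ> g) V ` V = {..<card S}" using g(3) kS by (metis image_comp image_restrict_eq)
      moreover have "restrict (k \<circ> g) V \<in> V \<rightarrow>\<^sub>E {..<card S}" using im by auto
      moreover have "monotone_on V R (\<le>) (restrict (k \<circ> g) V)"
        using g(1,2) kmono by (fastforce simp: monotone_on_def PiE_iff)
      ultimately show "restrict (k \<circ> g) V \<in> {g \<in> V \<rightarrow>\<^sub>E {..<card S}. monotone_on V R (\<le>) g \<and> g ` V = {..<card S}}"
        by blast
    qed
    show "restrict (k \<circ> restrict (h \<circ> g) V) V = g"
      if "g \<in> {g \<in> V \<rightarrow>\<^sub>E {..<card S}. monotone_on V R (\<le>) g \<and> g ` V = {..<card S}}" for g
      using that by (intro extensionalityI[of _ V]) (auto simp: PiE_def kh Pi_def)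
    show "restrict (h \<circ> restrict (k \<circ> g) V) V = g"
      if "g \<in> {g \<in> V \<rightarrow>\<^sub>E S. monotone_on V R (\<le>) g \<and> g ` V = S}" for g
      using that by (intro extensionalityI[of _ V]) (auto simp: PiE_def hk Pi_def)
  qed
  then show ?thesis by (simp add: bij_betw_same_card)
qed

lemma card_order_maps:
  assumes "finite (Field P)"
  shows "card (order_maps P n) =
    (\<Sum>k\<le>card (Field P). (n choose k) *
       card {g \<in> Field P \<rightarrow>\<^sub>E {..<k}. order_preserving P g \<and> g ` Field P = {..<k}})"
    (is "_ = (\<Sum>k\<le>?d. _ * ?e k)")
proof -
  let ?V = "Field P"
  let ?B = "\<lambda>S. {g \<in> ?V \<rightarrow>\<^sub>E S. order_preserving P g \<and> g ` ?V = S}"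
  let ?T = "{S. S \<subseteq> {1..n} \<and> card S \<le> ?d}"
  have finT: "finite ?T" by (rule finite_subset[of _ "Pow {1..n}"]) auto
  have fS: "finite S" if "S \<subseteq> {1..n}" for S :: "nat set"
    using that finite_subset by blast
  have "order_maps P n = (\<Union>S\<in>?T. ?B S)"
    using card_image_le[OF assms] by (fastforce simp: order_maps_def PiE_def)
  also have "card \<dots> = (\<Sum>S\<in>?T. card (?B S))"
  proof (rule card_UN_disjoint[OF finT])
    show "\<forall>S\<in>?T. finite (?B S)"
    proof
      fix S assume "S \<in> ?T"
      then have "finite (?V \<rightarrow>\<^sub>E S)" using assms fS by (intro finite_PiE) auto
      then show "finite (?B S)" by (rule rev_finite_subset) auto
    qed
  qed auto
  also have "\<dots> = (\<Sum>S\<in>?T. ?e (card S))"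
    using card_monotone_maps_onto[OF fS, of _ ?V "\<lambda>p q. (p, q) \<in> P"] by (intro sum.cong) auto
  also have "\<dots> = (\<Sum>k\<le>?d. \<Sum>S\<in>{S\<in>?T. card S = k}. ?e (card S))"
    by (rule sum.group[symmetric, OF finT]) auto
  also have "\<dots> = (\<Sum>k\<le>?d. (n choose k) * ?e k)"
  proof (rule sum.cong[OF refl])
    fix k assume "k \<in> {..?d}"
    then have "{S\<in>?T. card S = k} = {S. S \<subseteq> {1..n} \<and> card S = k}" by auto
    then show "(\<Sum>S\<in>{S\<in>?T. card S = k}. ?e (card S)) = (n choose k) * ?e k"
      using n_subsets[of "{1..n}" k] by simp
  qed
  finally show ?thesis .
qed

lemma ex1_order_poly:
  assumes "finite_poset P"
  shows "\<exists>!p::rat poly. \<forall>n\<ge>1. poly p (of_nat n) = of_nat (card (order_maps P n))"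
proof (rule ex_ex1I)
  define e where "e k = card {g \<in> Field P \<rightarrow>\<^sub>E {..<k}. order_preserving P g \<and> g ` Field P = {..<k}}"
    for k :: nat
  define b :: "nat \<Rightarrow> rat poly" where
    "b k = smult (1 / fact k) (\<Prod>i<k. [:- of_nat i, 1:])" for k
  have b: "poly (b k) (of_nat n) = of_nat (n choose k)" for k n :: nat
    by (simp add: b_def poly_prod binomial_gbinomial gbinomial_prod_rev lessThan_atLeast0)
  have "poly (\<Sum>k\<le>card (Field P). smult (of_nat (e k)) (b k)) (of_nat n) =
      of_nat (card (order_maps P n))" for n
    using assms card_order_maps[of P n]
    by (simp add: finite_poset_def poly_sum b e_def mult.commute)
  then show "\<exists>p::rat poly. \<forall>n\<ge>1. poly p (of_nat n) = of_nat (card (order_maps P n))"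
    by blast
next
  fix p q :: "rat poly"
  assume p: "\<forall>n\<ge>1. poly p (of_nat n) = of_nat (card (order_maps P n))"
    and q: "\<forall>n\<ge>1. poly q (of_nat n) = of_nat (card (order_maps P n))"
  have "of_nat ` {1..} \<subseteq> {x. poly (p - q) x = 0}" using p q by auto
  moreover have "infinite (of_nat ` {1::nat..} :: rat set)"
    using finite_imageD[of "of_nat :: nat \<Rightarrow> rat" "{1..}"] infinite_Ici by (auto simp: inj_on_def)
  ultimately have "infinite {x. poly (p - q) x = 0}" using infinite_super by blast
  then show "p = q" using poly_roots_finite[of "p - q"] by auto
qed

lemma poly_order_poly:
  assumes "finite_poset P" and "n \<ge> 1"
  shows "poly (order_poly P) (of_nat n) = of_nat (card (order_maps P n))"
  using theI'[OF ex1_order_poly[OF assms(1)]] assms(2) unfolding order_poly_def by blast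

lemma ex_min_elem_below:
  assumes "finite_poset P" and "p \<in> Field P"
  shows "\<exists>m \<in> min_elems P. (m, p) \<in> P"
proof -
  have po: "Partial_order P" and fin: "finite (Field P)"
    using assms(1) by (auto simp: finite_poset_def)
  have "finite P" using fin by (intro finite_subset[of P "Field P \<times> Field P"]) (auto simp: Field_def)
  then have wf: "wf (P - Id)" using po partial_order_on_well_order_on by blast
  have trans: "trans P" and pp: "(p, p) \<in> P"
    using po assms(2) by (auto simp: partial_order_on_def preorder_on_def refl_on_def)
  obtain m where m: "(m, p) \<in> P" "\<And>q. (q, m) \<in> P - Id \<Longrightarrow> (q, p) \<notin> P"
    using wfE_min[OF wf, of p "{q. (q, p) \<in> P}"] pp by auto
  have "m \<in> min_elems P"
    using m transD[OF trans] by (auto simp: min_elems_def Field_def)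
  then show ?thesis using m(1) by blast
qed

lemma ex_max_elem_above:
  assumes "finite_poset P" and "p \<in> Field P"
  shows "\<exists>m \<in> max_elems P. (p, m) \<in> P"
  using ex_min_elem_below[of "P\<inverse>" p] assms
  by (auto simp: finite_poset_def min_elems_def max_elems_def)

lemma finite_integer_points:
  assumes P: "finite_poset P" and A: "A \<subseteq> Field P" "min_elems P \<union> max_elems P \<subseteq> A"
  shows "finite (marked_order_polytope P A lam \<inter> (Field P \<rightarrow>\<^sub>E \<int>))"
proof -
  have fin: "finite (Field P)" using P by (simp add: finite_poset_def)
  then have finA: "finite A" using A(1) finite_subset by blast
  define B :: "real set" where "B = of_int ` {Min (lam ` A)..Max (lam ` A)}"
  have "h p \<in> B" if h: "h \<in> marked_order_polytope P A lam" "h \<in> Field P \<rightarrow>\<^sub>E \<int>" and p: "p \<in> Field P"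
    for h p
  proof -
    obtain k where k: "h p = of_int k" using h(2) p by (auto simp: PiE_iff Ints_def)
    obtain m m' where m: "m \<in> min_elems P" "(m, p) \<in> P" and m': "m' \<in> max_elems P" "(p, m') \<in> P"
      using ex_min_elem_below[OF P p] ex_max_elem_above[OF P p] by blast
    have mA: "m \<in> A" "m' \<in> A" using m m' A(2) by auto
    then have "m \<in> Field P" "m' \<in> Field P" using A(1) by auto
    then have "h m \<le> h p" "h p \<le> h m'"
      using h(1) m(2) m'(2) p unfolding marked_order_polytope_def monotone_on_def by blast+
    then have "lam m \<le> k" "k \<le> lam m'"
      using h(1) mA k by (auto simp: marked_order_polytope_def)
    moreover have "Min (lam ` A) \<le> lam m" "lam m' \<le> Max (lam ` A)" using finA mA by auto
    ultimately show ?thesis by (auto simp: B_def k)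
  qed
  then have "marked_order_polytope P A lam \<inter> (Field P \<rightarrow>\<^sub>E \<int>) \<subseteq> Field P \<rightarrow>\<^sub>E B"
    by (auto simp: PiE_iff)
  moreover have "finite (Field P \<rightarrow>\<^sub>E B)" using fin by (intro finite_PiE) (auto simp: B_def)
  ultimately show ?thesis by (rule finite_subset)
qed

end

theory Submission
  imports Defs
begin

text \<open>
  Splitting a map \<open>P \<rightarrow> {1..m + n}\<close> at \<open>m\<close> gives \<open>\<Omega>\<^sub>P(m + n) = \<Sum>\<^sub>I \<Omega>\<^sub>I(m) \<Omega>\<^bsub>P - I\<^esub>(n)\<close> over
  the ideals \<open>I\<close>. The derivative in \<open>m\<close> at \<open>0\<close> expresses \<open>\<Omega>\<^sub>P'\<close> through linear coefficients of ideals
  and order polynomials of smaller filters, so by induction all coefficients of \<open>\<Omega>\<^sub>P\<close> are nonnegative.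

  An extension \<open>h\<close> of the marking is sorted by the level of each element \<open>p\<close>: the least \<open>i\<close> with
  \<open>h p \<le> \<lambda>(a\<^sub>i)\<close> such that no \<open>a\<^sub>j\<close> with \<open>j > i\<close> lies below \<open>p\<close>. For a fixed level map, the elements of
  level \<open>i\<close> above \<open>a\<^sub>i\<close> take the value \<open>\<lambda>(a\<^sub>i)\<close>, and the others form a subposet \<open>Q\<^sub>i\<close>, a filter of an
  ideal of \<open>P\<close>, mapped independently into an interval of \<open>t\<^sub>i\<close> integers. Hence the count is a sum, over
  level maps, of products of the \<open>\<Omega>\<^bsub>Q\<^sub>i\<^esub>(t\<^sub>i)\<close>.
\<close>

section \<open>Coefficients of the order polynomial\<close>

lemma Field_Restr_poset:
  assumes "finite_poset P" "I \<subseteq> Field P"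
  shows "Field (Restr P I) = I"
  using assms Refl_Field_Restr[of P I]
  by (auto simp: finite_poset_def partial_order_on_def preorder_on_def)

lemma poly_eqI_nat:
  fixes p q :: "rat poly"
  assumes "\<And>n::nat. poly p (of_nat n) = poly q (of_nat n)"
  shows "p = q"
proof -
  have "range of_nat \<subseteq> {x. poly (p - q) x = 0}" using assms by auto
  moreover have "infinite (range (of_nat :: nat \<Rightarrow> rat))"
    by (simp add: finite_image_iff inj_on_def)
  ultimately have "infinite {x. poly (p - q) x = 0}" using infinite_super by blast
  then show ?thesis using poly_roots_finite[of "p - q"] by auto
qed

text \<open>The defining property of \<open>order_poly\<close> starts at \<open>n = 1\<close>. The
  value at 0 is needed for constant coefficients and for consecutive labels carrying equal values;
  it follows because the binomial expansion of the count also holds at 0.\<close>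

lemma poly_order_poly_nat:
  assumes "finite_poset P"
  shows "poly (order_poly P) (of_nat n) = of_nat (card (order_maps P n))"
proof -
  define e where "e k = card {g \<in> Field P \<rightarrow>\<^sub>E {..<k}. order_preserving P g \<and> g ` Field P = {..<k}}"
    for k :: nat
  \<comment> \<open>\<open>b k\<close> is the binomial coefficient polynomial "x choose k".\<close>
  define b :: "nat \<Rightarrow> rat poly" where
    "b k = smult (1 / fact k) (\<Prod>i<k. [:- of_nat i, 1:])" for k
  define p where "p = (\<Sum>k\<le>card (Field P). smult (of_nat (e k)) (b k))"
  have b: "poly (b k) (of_nat n) = of_nat (n choose k)" for k n :: nat
    by (simp add: b_def poly_prod binomial_gbinomial gbinomial_prod_rev lessThan_atLeast0)
  have p: "poly p (of_nat n) = of_nat (card (order_maps P n))" for n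
    using assms card_order_maps[of P n]
    by (simp add: p_def finite_poset_def poly_sum b e_def mult.commute)
  have "order_poly P = p"
    unfolding order_poly_def using p ex1_order_poly[OF assms] by (intro the1_equality) auto
  then show ?thesis using p by simp
qed

section \<open>Splitting order preserving maps at a threshold\<close>

lemma order_maps_iff:
  "g \<in> order_maps P n \<longleftrightarrow>
    g \<in> extensional (Field P) \<and> (\<forall>p\<in>Field P. 1 \<le> g p \<and> g p \<le> n) \<and>
    (\<forall>p q. (p, q) \<in> P \<longrightarrow> g p \<le> g q)"
  by (auto simp: order_maps_def PiE_def monotone_on_def FieldI1 FieldI2)

lemma finite_order_maps: "finite (Field P) \<Longrightarrow> finite (order_maps P n)"
  unfolding order_maps_def by (rule finite_subset[of _ "Field P \<rightarrow>\<^sub>E {1..n}"]) (auto intro: finite_PiE)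

lemma order_ideal_subset: "order_ideal P I \<Longrightarrow> I \<subseteq> Field P"
  by (simp add: order_ideal_def)

lemma finite_Field_Restr: "finite (Field P) \<Longrightarrow> finite (Field (Restr P I))"
  using mono_Field[of "Restr P I" P] finite_subset by auto

lemma finite_poset_Restr: "finite_poset P \<Longrightarrow> finite_poset (Restr P I)"
  by (simp add: finite_poset_def Partial_order_Restr finite_Field_Restr)

lemma card_order_maps_add:
  assumes P: "finite_poset P"
  shows "card (order_maps P (m + n)) =
    (\<Sum>I | order_ideal P I. card (order_maps (Restr P I) m) * card (order_maps (Restr P (Field P - I)) n))"
proof -
  let ?V = "Field P"
  let ?X = "SIGMA I:{I. order_ideal P I}. order_maps (Restr P I) m \<times> order_maps (Restr P (?V - I)) n"
  let ?f = "\<lambda>g. ({p\<in>?V. g p \<le> m}, restrict g {p\<in>?V. g p \<le> m}, \<lambda>p\<in>?V - {p\<in>?V. g p \<le> m}. g p - m)"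
  let ?h = "\<lambda>(I, u, v). \<lambda>p\<in>?V. if p \<in> I then u p else v p + m"
  have V: "finite ?V" using P by (simp add: finite_poset_def)
  have FR: "Field (Restr P I) = I" if "I \<subseteq> ?V" for I using Field_Restr_poset[OF P that] .
  have "bij_betw ?f (order_maps P (m + n)) ?X"
  proof (rule bij_betwI[where g = ?h])
    show "?f \<in> order_maps P (m + n) \<rightarrow> ?X"
    proof
      fix g assume g: "g \<in> order_maps P (m + n)"
      let ?I = "{p\<in>?V. g p \<le> m}"
      have "order_ideal P ?I"
        using g by (fastforce simp: order_ideal_def order_maps_iff FieldI1)
      moreover have "restrict g ?I \<in> order_maps (Restr P ?I) m"
        using g FR[of ?I] by (auto simp: order_maps_iff)
      moreover have "(\<lambda>p\<in>?V - ?I. g p - m) \<in> order_maps (Restr P (?V - ?I)) n"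
        using g FR[of "?V - ?I"] by (auto simp: order_maps_iff intro: diff_le_mono)
      ultimately show "?f g \<in> ?X" by simp
    qed
    have main: "?h (I, u, v) \<in> order_maps P (m + n) \<and> ?f (?h (I, u, v)) = (I, u, v)"
      if I: "order_ideal P I" and u: "u \<in> order_maps (Restr P I) m"
        and v: "v \<in> order_maps (Restr P (?V - I)) n" for I u v
    proof
      have IV: "I \<subseteq> ?V" using I by (simp add: order_ideal_def)
      have u1: "1 \<le> u p" "u p \<le> m" if "p \<in> I" for p
        using u that FR[OF IV] by (auto simp: order_maps_iff)
      have v1: "1 \<le> v p" "v p \<le> n" if "p \<in> ?V" "p \<notin> I" for p
        using v that FR[of "?V - I"] by (auto simp: order_maps_iff)
      have ext: "u \<in> extensional I" "v \<in> extensional (?V - I)"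
        using u v FR[OF IV] FR[of "?V - I"] by (auto simp: order_maps_iff)
      have mono: "?h (I, u, v) p \<le> ?h (I, u, v) q" if "(p, q) \<in> P" for p q
      proof -
        have pq: "p \<in> ?V" "q \<in> ?V" using that by (auto intro: FieldI1 FieldI2)
        have "p \<in> I" if "q \<in> I" using I that \<open>(p, q) \<in> P\<close> by (auto simp: order_ideal_def)
        moreover have "u p \<le> u q" if "p \<in> I" "q \<in> I"
          using u that \<open>(p, q) \<in> P\<close> by (auto simp: order_maps_iff)
        moreover have "v p \<le> v q" if "p \<notin> I" "q \<notin> I"
          using v that \<open>(p, q) \<in> P\<close> pq by (auto simp: order_maps_iff)
        ultimately show ?thesis
          using pq u1[of p] by (auto intro: trans_le_add2)
      qed
      show "?h (I, u, v) \<in> order_maps P (m + n)"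
        unfolding order_maps_iff
      proof (intro conjI ballI allI impI)
        fix p assume "p \<in> ?V"
        then show "1 \<le> ?h (I, u, v) p" "?h (I, u, v) p \<le> m + n"
          using u1[of p] v1[of p] by auto
      next
        fix p q assume "(p, q) \<in> P"
        then show "?h (I, u, v) p \<le> ?h (I, u, v) q" by (rule mono)
      qed simp
      \<comment> \<open>The ideal can be read off the glued map: values are at most \<open>m\<close>
        on \<open>I\<close>, and at least \<open>m + 1\<close> outside because \<open>v\<close>
        starts at 1.\<close>
      have eq: "{p\<in>?V. ?h (I, u, v) p \<le> m} = I"
      proof (rule set_eqI)
        fix p show "p \<in> {p\<in>?V. ?h (I, u, v) p \<le> m} \<longleftrightarrow> p \<in> I"
          using subsetD[OF IV, of p] u1[of p] v1[of p] by auto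
      qed
      have "restrict (?h (I, u, v)) I = u"
        using ext(1) subsetD[OF IV] by (intro extensionalityI[of _ I] restrict_extensional) simp_all
      moreover have "(\<lambda>p\<in>?V - I. ?h (I, u, v) p - m) = v"
        using ext(2) by (intro extensionalityI[of _ "?V - I"] restrict_extensional) simp_all
      ultimately show "?f (?h (I, u, v)) = (I, u, v)"
        unfolding eq by simp
    qed
    have h: "?h y \<in> order_maps P (m + n) \<and> ?f (?h y) = y" if "y \<in> ?X" for y
    proof -
      obtain I u v where y: "y = (I, u, v)" by (cases y)
      then have "order_ideal P I" "u \<in> order_maps (Restr P I) m"
        "v \<in> order_maps (Restr P (?V - I)) n"
        using that by simp_all
      then show ?thesis unfolding y by (rule main)
    qed
    show "?h \<in> ?X \<rightarrow> order_maps P (m + n)" by (rule funcsetI) (rule conjunct1[OF h])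
    show "?f (?h y) = y" if "y \<in> ?X" for y using conjunct2[OF h[OF that]] .
    show "?h (?f g) = g" if "g \<in> order_maps P (m + n)" for g
    proof (rule extensionalityI[of _ ?V])
      show "g \<in> extensional ?V" using that by (simp add: order_maps_iff)
    qed auto
  qed
  then have "card (order_maps P (m + n)) = card ?X" by (rule bij_betw_same_card)
  also have "\<dots> = (\<Sum>I | order_ideal P I. card (order_maps (Restr P I) m \<times> order_maps (Restr P (?V - I)) n))"
  proof (rule card_SigmaI)
    show "finite {I. order_ideal P I}"
      by (rule finite_subset[of _ "Pow ?V"]) (auto simp: V dest: order_ideal_subset)
    show "\<forall>I\<in>{I. order_ideal P I}. finite (order_maps (Restr P I) m \<times> order_maps (Restr P (?V - I)) n)"
      by (intro ballI finite_cartesian_product finite_order_maps finite_Field_Restr V)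
  qed
  finally show ?thesis by (simp add: card_cartesian_product)
qed

text \<open>Read as a polynomial identity in \<open>m\<close>, the addition formula \<open>card_order_maps_add\<close> is
  differentiated at \<open>m = 0\<close>.\<close>

lemma pderiv_order_poly:
  assumes P: "finite_poset P"
  shows "pderiv (order_poly P) =
    (\<Sum>I | order_ideal P I. smult (coeff (order_poly (Restr P I)) 1) (order_poly (Restr P (Field P - I))))"
proof (rule poly_eqI_nat)
  fix n :: nat
  note R = finite_poset_Restr[OF P]
  have "pcompose (order_poly P) [:of_nat n, 1:] =
    (\<Sum>I | order_ideal P I. smult (of_nat (card (order_maps (Restr P (Field P - I)) n))) (order_poly (Restr P I)))"
  proof (rule poly_eqI_nat)
    fix m :: nat
    have "poly (pcompose (order_poly P) [:of_nat n, 1:]) (of_nat m) = of_nat (card (order_maps P (m + n)))"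
      using poly_order_poly_nat[OF P, of "m + n"] by (simp add: poly_pcompose add.commute)
    then show "poly (pcompose (order_poly P) [:of_nat n, 1:]) (of_nat m) = poly
      (\<Sum>I | order_ideal P I. smult (of_nat (card (order_maps (Restr P (Field P - I)) n))) (order_poly (Restr P I))) (of_nat m)"
      by (simp add: card_order_maps_add[OF P] poly_sum poly_order_poly_nat[OF R] mult.commute)
  qed
  \<comment> \<open>The linear coefficient of p(x + c) is p'(c), so comparing linear coefficients in
    the identity above evaluates the derivative at \<open>n\<close>.\<close>
  moreover have "coeff (pcompose p [:c, 1:]) 1 = poly (pderiv p) c" for p :: "rat poly" and c
  proof -
    have "coeff (pcompose p [:c, 1:]) 1 = poly (pderiv (pcompose p [:c, 1:])) 0"
      by (simp add: poly_0_coeff_0 coeff_pderiv)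
    then show ?thesis by (simp add: pderiv_pcompose poly_pcompose pderiv_pCons)
  qed
  ultimately have "poly (pderiv (order_poly P)) (of_nat n) = (\<Sum>I | order_ideal P I.
      of_nat (card (order_maps (Restr P (Field P - I)) n)) * coeff (order_poly (Restr P I)) 1)"
    by (metis (no_types, lifting) coeff_smult coeff_sum sum.cong)
  then show "poly (pderiv (order_poly P)) (of_nat n) = poly
    (\<Sum>I | order_ideal P I. smult (coeff (order_poly (Restr P I)) 1) (order_poly (Restr P (Field P - I)))) (of_nat n)"
    by (simp add: poly_sum poly_order_poly_nat[OF R] mult.commute)
qed

section \<open>Nonnegativity of all coefficients\<close>

lemma order_poly_empty_field:
  assumes "Field P = {}"
  shows "order_poly P = 1"
proof (rule poly_eqI_nat)
  fix n :: nat
  have "P = {}" using assms by (auto simp: Field_def)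
  then have "finite_poset P" "order_maps P n = {\<lambda>_. undefined}"
    by (auto simp: finite_poset_def order_maps_iff)
  then show "poly (order_poly P) (of_nat n) = poly 1 (of_nat n)"
    by (simp add: poly_order_poly_nat)
qed

lemma order_filter_Diff: "order_ideal P I \<Longrightarrow> order_filter P (Field P - I)"
  unfolding order_ideal_def order_filter_def by (blast intro: FieldI2)

text \<open>In the formula for the derivative, ideals contribute linear coefficients, nonnegative by
  hypothesis, and their complements are filters, hence in the family and open to induction on the
  size of the poset.\<close>

lemma coeff_order_poly_nonneg:
  fixes F :: "'a rel set"
  assumes posets: "\<And>Q. Q \<in> F \<Longrightarrow> finite_poset Q"
    and closed_ideals: "\<And>Q I. Q \<in> F \<Longrightarrow> order_ideal Q I \<Longrightarrow> Restr Q I \<in> F"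
    and closed_filters: "\<And>Q I. Q \<in> F \<Longrightarrow> order_filter Q I \<Longrightarrow> Restr Q I \<in> F"
    and linear_term: "\<And>Q. Q \<in> F \<Longrightarrow> coeff (order_poly Q) 1 \<ge> 0"
    and "P \<in> F"
  shows "coeff (order_poly P) k \<ge> 0"
  using \<open>P \<in> F\<close>
proof (induction "card (Field P)" arbitrary: P k rule: less_induct)
  case less
  have P: "finite_poset P" using posets less.prems .
  show ?case
  proof (cases k)
    case 0
    have "coeff (order_poly P) 0 = of_nat (card (order_maps P 0))"
      using poly_order_poly_nat[OF P, of 0] by (simp add: poly_0_coeff_0)
    then show ?thesis using 0 by simp
  next
    case (Suc j)
    have "coeff (order_poly (Restr P I)) 1 * coeff (order_poly (Restr P (Field P - I))) j \<ge> 0"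
      if I: "order_ideal P I" for I
    proof (cases "I = {}")
      \<comment> \<open>Here the complement is all of \<open>P\<close>, out of reach of the
        induction hypothesis, but the term vanishes: the constant polynomial 1 has linear
        coefficient 0.\<close>
      case True
      then have "order_poly (Restr P I) = 1" by (intro order_poly_empty_field) simp
      then show ?thesis by simp
    next
      case False
      have "card (Field (Restr P (Field P - I))) < card (Field P)"
        using False order_ideal_subset[OF I] P unfolding Field_Restr_poset[OF P Diff_subset]
        by (intro psubset_card_mono) (auto simp: finite_poset_def)
      then have "coeff (order_poly (Restr P (Field P - I))) j \<ge> 0"
        using closed_filters[OF less.prems order_filter_Diff[OF I]] by (rule less.hyps)
      then show ?thesis using linear_term closed_ideals[OF less.prems I] by simp
    qed
    then have "coeff (pderiv (order_poly P)) j \<ge> 0"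
      by (auto simp: pderiv_order_poly[OF P] coeff_sum intro: sum_nonneg)
    then show ?thesis by (simp add: Suc coeff_pderiv zero_le_mult_iff)
  qed
qed


section \<open>Decomposing the extensions of a marking\<close>

text \<open>Passes from real points with integer coordinates to integer-valued maps; the floor
  inverts the embedding on such points.\<close>

lemma marked_order_count_int:
  assumes "A \<subseteq> Field P"
  shows "marked_order_count P A lam =
    card {h \<in> Field P \<rightarrow>\<^sub>E UNIV. order_preserving P h \<and> (\<forall>x\<in>A. h x = lam x)}"
    (is "_ = card ?H")
proof -
  have "bij_betw (\<lambda>h. \<lambda>p\<in>Field P. real_of_int (h p)) ?H
    (marked_order_polytope P A lam \<inter> (Field P \<rightarrow>\<^sub>E \<int>))"
  proof (rule bij_betwI[where g = "\<lambda>h. \<lambda>p\<in>Field P. \<lfloor>h p\<rfloor>"])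
    show "(\<lambda>h. \<lambda>p\<in>Field P. real_of_int (h p)) \<in>
        ?H \<rightarrow> marked_order_polytope P A lam \<inter> (Field P \<rightarrow>\<^sub>E \<int>)"
      using assms by (auto simp: marked_order_polytope_def monotone_on_def)
    show "(\<lambda>h. \<lambda>p\<in>Field P. \<lfloor>h p\<rfloor>) \<in>
        marked_order_polytope P A lam \<inter> (Field P \<rightarrow>\<^sub>E \<int>) \<rightarrow> ?H"
      using assms unfolding marked_order_polytope_def monotone_on_def
      by (auto simp: subset_iff intro!: floor_mono)
    show "(\<lambda>p\<in>Field P. \<lfloor>(\<lambda>p\<in>Field P. real_of_int (h p)) p\<rfloor>) = h" if "h \<in> ?H" for h
      using that by (intro extensionalityI[of _ "Field P"]) (auto simp: PiE_def)
    show "(\<lambda>p\<in>Field P. real_of_int ((\<lambda>p\<in>Field P. \<lfloor>h p\<rfloor>) p)) = h"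
      if "h \<in> marked_order_polytope P A lam \<inter> (Field P \<rightarrow>\<^sub>E \<int>)" for h
      using that by (intro extensionalityI[of _ "Field P"]) (auto simp: PiE_def Pi_def elim: Ints_cases)
  qed
  then show ?thesis by (simp add: marked_order_count_def bij_betw_same_card)
qed

section \<open>Level maps of a poset with naturally labeled marked elements\<close>

locale marked_poset =
  fixes P :: "'a rel" and A :: "'a set" and r :: nat and a :: "nat \<Rightarrow> 'a"
  assumes poset: "finite_poset P"
    and A_subset: "A \<subseteq> Field P"
    and min_max: "min_elems P \<union> max_elems P \<subseteq> A"
    and labeling: "natural_labeling P A r a"
begin

lemma P_refl: "p \<in> Field P \<Longrightarrow> (p, p) \<in> P"
  using poset by (auto simp: finite_poset_def partial_order_on_def preorder_on_def refl_on_def)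

lemma P_trans: "(p, q) \<in> P \<Longrightarrow> (q, s) \<in> P \<Longrightarrow> (p, s) \<in> P"
  using poset transD[of P p q s] by (simp add: finite_poset_def partial_order_on_def preorder_on_def)

lemma finite_Field: "finite (Field P)"
  using poset by (simp add: finite_poset_def)

lemma image_label: "a ` {0..r} = A"
  using labeling by (simp add: natural_labeling_def bij_betw_def)

lemma label_in_Field: "i \<le> r \<Longrightarrow> a i \<in> Field P"
  using image_label A_subset by auto

lemma label_le: "i \<le> r \<Longrightarrow> j \<le> r \<Longrightarrow> (a i, a j) \<in> P \<Longrightarrow> i \<le> j"
  using labeling inj_onD[of a "{0..r}" i j]
  unfolding natural_labeling_def bij_betw_def by (metis atLeastAtMost_iff le0 less_imp_le order_refl)

lemma ex_label_below:
  assumes "p \<in> Field P"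
  shows "\<exists>i\<le>r. (a i, p) \<in> P"
proof -
  obtain m where m: "m \<in> min_elems P" "(m, p) \<in> P" using ex_min_elem_below[OF poset assms] by blast
  then have "m \<in> a ` {0..r}" unfolding image_label using min_max by blast
  then show ?thesis using m(2) by auto
qed

lemma ex_label_above:
  assumes "p \<in> Field P"
  shows "\<exists>i\<le>r. (p, a i) \<in> P"
proof -
  obtain m where m: "m \<in> max_elems P" "(p, m) \<in> P" using ex_max_elem_above[OF poset assms] by blast
  then have "m \<in> a ` {0..r}" unfolding image_label using min_max by blast
  then show ?thesis using m(2) by auto
qed

text \<open>The index set of the decomposition. It does not depend on the marking, which is why a
  single polynomial serves all markings.\<close>

definition levelings :: "('a \<Rightarrow> nat) set" where
  "levelings = {l \<in> Field P \<rightarrow>\<^sub>E {0..r}. order_preserving P l \<and> (\<forall>i\<le>r. l (a i) = i)}"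

text \<open>On level \<open>i\<close>, the elements above \<open>a i\<close> are forced to the value \<open>lam (a i)\<close>; the others form
  the \<open>piece\<close>, on which the value ranges freely over the half-open interval from \<open>lam (a (i - 1))\<close>
  to \<open>lam (a i)\<close>. This convention keeps the count correct when the two ends coincide. On level \<open>0\<close> every element is above \<open>a 0\<close>, so the
  truncated \<open>0 - 1\<close> never matters.\<close>

definition piece :: "('a \<Rightarrow> nat) \<Rightarrow> nat \<Rightarrow> 'a set" where
  "piece l i = {p \<in> Field P. l p = i \<and> (a i, p) \<notin> P}"

text \<open>The extensions with level map \<open>l\<close>. Monotonicity is imposed only within a
  level, so that the levels become independent factors; across levels it follows from the order of
  the intervals.\<close>

definition block :: "('a \<Rightarrow> int) \<Rightarrow> ('a \<Rightarrow> nat) \<Rightarrow> ('a \<Rightarrow> int) set" where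
  "block lam l = {h \<in> Field P \<rightarrow>\<^sub>E UNIV.
     (\<forall>p\<in>Field P. (a (l p), p) \<in> P \<longrightarrow> h p = lam (a (l p))) \<and>
     (\<forall>p\<in>Field P. (a (l p), p) \<notin> P \<longrightarrow> lam (a (l p - 1)) < h p \<and> h p \<le> lam (a (l p))) \<and>
     (\<forall>p q. (p, q) \<in> P \<longrightarrow> l p = l q \<longrightarrow> h p \<le> h q)}"

text \<open>The clause on labels below \<open>p\<close> keeps \<open>a i\<close> at level
  \<open>i\<close> even when consecutive labels carry equal values.\<close>

definition level_of :: "('a \<Rightarrow> int) \<Rightarrow> ('a \<Rightarrow> int) \<Rightarrow> 'a \<Rightarrow> nat" where
  "level_of lam h p = (LEAST i. h p \<le> lam (a i) \<and> (\<forall>j\<le>r. (a j, p) \<in> P \<longrightarrow> j \<le> i))"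

lemma levelingsD:
  assumes "l \<in> levelings"
  shows "p \<in> Field P \<Longrightarrow> l p \<le> r" "(p, q) \<in> P \<Longrightarrow> l p \<le> l q" "i \<le> r \<Longrightarrow> l (a i) = i"
    and "l \<in> extensional (Field P)"
  using assms by (auto simp: levelings_def PiE_def monotone_on_def FieldI1 FieldI2)

lemma blockD:
  assumes "h \<in> block lam l" "p \<in> Field P"
  shows "(a (l p), p) \<in> P \<Longrightarrow> h p = lam (a (l p))"
    and "(a (l p), p) \<notin> P \<Longrightarrow> lam (a (l p - 1)) < h p"
    and "h p \<le> lam (a (l p))"
  using assms unfolding block_def by fastforce+

lemma finite_levelings: "finite levelings"
  unfolding levelings_def
  by (rule finite_subset[of _ "Field P \<rightarrow>\<^sub>E {0..r}"]) (auto intro: finite_PiE finite_Field)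

text \<open>Some label lies below \<open>p\<close>, and its index is its level, so at level 0 it can
  only be \<open>a 0\<close>. Thus nothing is free on level 0 and the product can start at
  1.\<close>

lemma level_zero_above_label:
  assumes "l \<in> levelings" "p \<in> Field P" "l p = 0"
  shows "(a 0, p) \<in> P"
proof -
  obtain i where "i \<le> r" "(a i, p) \<in> P" using ex_label_below assms(2) by blast
  then show ?thesis
    using levelingsD(2)[OF assms(1), of "a i" p] levelingsD(3)[OF assms(1), of i] assms(3) by simp
qed

section \<open>Decomposition for a marking weakly increasing along the labeling\<close>

context
  fixes lam :: "'a \<Rightarrow> int"
  assumes lam_step: "\<forall>i\<in>{1..r}. lam (a (i - 1)) \<le> lam (a i)"
begin

lemma lam_mono: "i \<le> j \<Longrightarrow> j \<le> r \<Longrightarrow> lam (a i) \<le> lam (a j)"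
proof (induction j)
  case (Suc j)
  then have "lam (a j) \<le> lam (a (Suc j))" using lam_step by force
  then show ?case using Suc by (cases "i = Suc j") auto
qed simp

text \<open>If the level rises strictly from \<open>p\<close> to \<open>q\<close>, then
  \<open>lam (a (l q - 1))\<close> separates the two values: it is at least the upper end for
  \<open>p\<close> and at most \<open>h q\<close>, whether \<open>q\<close> is forced or
  free.\<close>

lemma block_monotone:
  assumes l: "l \<in> levelings" and h: "h \<in> block lam l" and pq: "(p, q) \<in> P"
  shows "h p \<le> h q"
proof (cases "l p = l q")
  case True
  then show ?thesis using h pq by (simp add: block_def)
next
  case False
  have F: "p \<in> Field P" "q \<in> Field P" using pq by (auto intro: FieldI1 FieldI2)
  have lt: "l p < l q" using False levelingsD(2)[OF l pq] by simp
  have "h p \<le> lam (a (l p))" using blockD(3)[OF h F(1)] .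
  also have "\<dots> \<le> lam (a (l q - 1))" using lt levelingsD(1)[OF l F(2)] by (intro lam_mono) auto
  also have "\<dots> \<le> h q"
    using blockD(1,2)[OF h F(2)] lam_mono[of "l q - 1" "l q"] levelingsD(1)[OF l F(2)]
    by (cases "(a (l q), q) \<in> P") auto
  finally show ?thesis .
qed

text \<open>Since \<open>h\<close> determines its level map, distinct blocks are disjoint.\<close>

lemma level_of_block:
  assumes l: "l \<in> levelings" and h: "h \<in> block lam l" and p: "p \<in> Field P"
  shows "level_of lam h p = l p"
  unfolding level_of_def
proof (rule Least_equality)
  show "h p \<le> lam (a (l p)) \<and> (\<forall>j\<le>r. (a j, p) \<in> P \<longrightarrow> j \<le> l p)"
    using blockD(3)[OF h p] levelingsD(2,3)[OF l] by force
  fix i assume i: "h p \<le> lam (a i) \<and> (\<forall>j\<le>r. (a j, p) \<in> P \<longrightarrow> j \<le> i)"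
  show "l p \<le> i"
  proof (rule ccontr)
    \<comment> \<open>Such an \<open>i\<close> excludes \<open>a (l p)\<close> from lying below
      \<open>p\<close>, so \<open>p\<close> is free, and the strict lower bound of its interval
      contradicts \<open>h p \<le> lam (a i)\<close>.\<close>
    assume "\<not> l p \<le> i"
    then have lt: "i < l p" by simp
    then have "(a (l p), p) \<notin> P" using i levelingsD(1)[OF l p] by fastforce
    then have "lam (a (l p - 1)) < h p" by (rule blockD(2)[OF h p])
    moreover have "lam (a i) \<le> lam (a (l p - 1))"
      using lt levelingsD(1)[OF l p] by (intro lam_mono) auto
    ultimately show False using i by simp
  qed
qed

lemma extensions_eq_UN_block:
  "{h \<in> Field P \<rightarrow>\<^sub>E UNIV. order_preserving P h \<and> (\<forall>x\<in>A. h x = lam x)} =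
    (\<Union>l\<in>levelings. block lam l)" (is "?H = _")
proof (intro equalityI subsetI)
  fix h assume "h \<in> ?H"
  then have ext: "h \<in> Field P \<rightarrow>\<^sub>E UNIV"
    and mono: "\<And>p q. (p, q) \<in> P \<Longrightarrow> h p \<le> h q" and mark: "\<And>i. i \<le> r \<Longrightarrow> h (a i) = lam (a i)"
    using image_label by (auto simp: monotone_on_def FieldI1 FieldI2)
  let ?Q = "\<lambda>p i. h p \<le> lam (a i) \<and> (\<forall>j\<le>r. (a j, p) \<in> P \<longrightarrow> j \<le> i)"
  define l where "l = restrict (level_of lam h) (Field P)"
  \<comment> \<open>An admissible index exists: \<open>p\<close> lies below some label, whose value
    is at most \<open>lam (a r)\<close>.\<close>
  have Qr: "?Q p r" if p: "p \<in> Field P" for p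
  proof -
    obtain i where "i \<le> r" "(p, a i) \<in> P" using ex_label_above p by blast
    then show ?thesis using mono[of p "a i"] mark lam_mono[of i r] by auto
  qed
  have Ql: "?Q p (l p)" and l_le: "\<And>i. ?Q p i \<Longrightarrow> l p \<le> i" if p: "p \<in> Field P" for p
    using LeastI[of "?Q p", OF Qr[OF p]] Least_le[of "?Q p"] p by (simp_all add: l_def level_of_def)
  have l: "l \<in> levelings"
  proof -
    \<comment> \<open>Any index admissible for \<open>q\<close> is admissible for \<open>p\<close>,
      because fewer labels lie below \<open>p\<close> and its value is no larger.\<close>
    have "l p \<le> l q" if pq: "(p, q) \<in> P" for p q
    proof -
      have F: "p \<in> Field P" "q \<in> Field P" using pq by (auto intro: FieldI1 FieldI2)
      then show ?thesis using Ql[of q] mono[OF pq] P_trans pq by (intro l_le) (auto intro: order_trans)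
    qed
    moreover have "l (a i) = i" if i: "i \<le> r" for i
    proof (rule antisym)
      show "l (a i) \<le> i" using i mark label_le label_in_Field by (intro l_le) auto
      show "i \<le> l (a i)" using Ql[of "a i"] label_in_Field P_refl i by auto
    qed
    moreover have "l p \<le> r" if "p \<in> Field P" for p using l_le Qr that by blast
    moreover have "l \<in> extensional (Field P)" by (simp add: l_def)
    ultimately show ?thesis by (simp add: levelings_def monotone_on_def PiE_iff)
  qed
  have "h \<in> block lam l"
  proof -
    have "h p = lam (a (l p))" if p: "p \<in> Field P" and up: "(a (l p), p) \<in> P" for p
      using Ql[OF p] mono[OF up] mark[of "l p"] levelingsD(1)[OF l p] by simp
    \<comment> \<open>Otherwise \<open>l p - 1\<close> would be admissible too, against minimality;
      truncation leaves only \<open>l p = 0\<close>, where \<open>p\<close> would lie above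
      \<open>a 0\<close>.\<close>
    moreover have "lam (a (l p - 1)) < h p" if p: "p \<in> Field P" and nup: "(a (l p), p) \<notin> P" for p
    proof (rule ccontr)
      assume "\<not> lam (a (l p - 1)) < h p"
      moreover have "j \<le> l p - 1" if "j \<le> r" "(a j, p) \<in> P" for j
      proof -
        have "j \<noteq> l p" "j \<le> l p" using Ql[OF p] that nup by auto
        then show ?thesis by simp
      qed
      ultimately have "l p \<le> l p - 1" using p by (intro l_le) auto
      then show False using level_zero_above_label[OF l p] nup by (cases "l p") auto
    qed
    ultimately show ?thesis using ext mono Ql by (auto simp: block_def)
  qed
  then show "h \<in> (\<Union>l\<in>levelings. block lam l)" using l by blast
next
  fix h assume "h \<in> (\<Union>l\<in>levelings. block lam l)"
  then obtain l where l: "l \<in> levelings" and h: "h \<in> block lam l" by blast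
  have "h x = lam x" if x: "x \<in> A" for x
  proof -
    obtain i where i: "i \<le> r" "x = a i" using x unfolding image_label[symmetric] by auto
    then have "(a (l x), x) \<in> P" "l x = i" using levelingsD(3)[OF l] P_refl label_in_Field by auto
    then show ?thesis using blockD(1)[OF h, of x] i label_in_Field[of i] by simp
  qed
  then show "h \<in> ?H"
    using h block_monotone[OF l h] by (auto simp: block_def monotone_on_def)
qed

text \<open>Only the pieces leave a choice, and they do not interact. Subtracting
  \<open>lam (a (i - 1))\<close> moves the half-open interval of level \<open>i\<close> onto 1, ...,
  t_i, turning the choice on each piece into an order map.\<close>

lemma card_block:
  assumes l: "l \<in> levelings"
  shows "finite (block lam l)"
    and "card (block lam l) =
      (\<Prod>i=1..r. card (order_maps (Restr P (piece l i)) (nat (lam (a i) - lam (a (i - 1))))))"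
proof -
  let ?M = "\<lambda>i. order_maps (Restr P (piece l i)) (nat (lam (a i) - lam (a (i - 1))))"
  let ?f = "\<lambda>h. \<lambda>i\<in>{1..r}. \<lambda>p\<in>piece l i. nat (h p - lam (a (i - 1)))"
  let ?g = "\<lambda>k. \<lambda>p\<in>Field P. if (a (l p), p) \<in> P then lam (a (l p))
    else lam (a (l p - 1)) + int (k (l p) p)"
  have Fld: "Field (Restr P (piece l i)) = piece l i" for i
    using Field_Restr_poset[OF poset, of "piece l i"] by (auto simp: piece_def)
  have pos: "l p \<in> {1..r}" "p \<in> piece l (l p)" if "p \<in> Field P" "(a (l p), p) \<notin> P" for p
    using level_zero_above_label[OF l that(1)] levelingsD(1)[OF l that(1)] that
    by (auto simp: piece_def Suc_le_eq intro: gr0I)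
  have k1: "1 \<le> k i p" "int (k i p) \<le> lam (a i) - lam (a (i - 1))"
    if "k \<in> PiE {1..r} ?M" "i \<in> {1..r}" "p \<in> piece l i" for k i p
  proof -
    have "k i \<in> ?M i" using that by (auto simp: PiE_iff)
    then have "1 \<le> k i p" "k i p \<le> nat (lam (a i) - lam (a (i - 1)))"
      using that(3) unfolding order_maps_iff Fld by auto
    then show "1 \<le> k i p" "int (k i p) \<le> lam (a i) - lam (a (i - 1))" by auto
  qed
  have "bij_betw ?f (block lam l) (PiE {1..r} ?M)"
  proof (rule bij_betwI[where g = ?g])
    have "?f h i \<in> ?M i" if h: "h \<in> block lam l" and i: "i \<in> {1..r}" for h i
    proof -
      have "lam (a (i - 1)) < h p \<and> h p \<le> lam (a i)" if "p \<in> piece l i" for p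
        using blockD(2,3)[OF h, of p] that by (auto simp: piece_def)
      moreover have "h p \<le> h q" if "(p, q) \<in> P" for p q using block_monotone[OF l h that] .
      ultimately show ?thesis
        using i unfolding order_maps_iff Fld by (fastforce intro: nat_mono)
    qed
    then show "?f \<in> block lam l \<rightarrow> PiE {1..r} ?M" by auto
    have "?g k \<in> block lam l" if k: "k \<in> PiE {1..r} ?M" for k
    proof -
      have mono: "?g k p \<le> ?g k q" if pq: "(p, q) \<in> P" and eq: "l p = l q" for p q
      proof -
        have F: "p \<in> Field P" "q \<in> Field P" using pq by (auto intro: FieldI1 FieldI2)
        \<comment> \<open>Being above the label of its level is inherited upwards, so a forced
          \<open>p\<close> forces \<open>q\<close>. A free \<open>p\<close> below a forced
          \<open>q\<close> is bounded by the upper end of the interval; two free elements share a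
          piece.\<close>
        consider "(a (l p), p) \<in> P" | "(a (l p), p) \<notin> P" "(a (l q), q) \<in> P"
          | "(a (l p), p) \<notin> P" "(a (l q), q) \<notin> P" by blast
        then show ?thesis
        proof cases
          case 1
          then show ?thesis using P_trans[OF 1 pq] F eq by simp
        next
          case 2
          then show ?thesis using k1[OF k pos[OF F(1) 2(1)]] F eq by simp
        next
          case 3
          have "k (l p) \<in> ?M (l p)" using k pos(1)[OF F(1) 3(1)] by (auto simp: PiE_iff)
          moreover have "(p, q) \<in> Restr P (piece l (l p))"
            using pos(2)[OF F(1) 3(1)] pos(2)[OF F(2) 3(2)] pq eq by simp
          ultimately have "k (l p) p \<le> k (l p) q" unfolding order_maps_iff by blast
          then show ?thesis using 3 F eq by simp
        qed
      qed
      have "lam (a (l p - 1)) < ?g k p \<and> ?g k p \<le> lam (a (l p))"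
        if "p \<in> Field P" "(a (l p), p) \<notin> P" for p
        using k1[OF k pos[OF that]] that by simp
      then show ?thesis
        unfolding block_def using mono by (intro CollectI conjI ballI allI impI) simp_all
    qed
    then show "?g \<in> PiE {1..r} ?M \<rightarrow> block lam l" by blast
    show "?g (?f h) = h" if h: "h \<in> block lam l" for h
    proof (rule extensionalityI[of _ "Field P"])
      fix p assume p: "p \<in> Field P"
      show "?g (?f h) p = h p"
      proof (cases "(a (l p), p) \<in> P")
        case True
        then show ?thesis using blockD(1)[OF h p] p by simp
      next
        case False
        \<comment> \<open>Makes the difference positive, so that \<open>nat\<close> loses
          nothing.\<close>
        moreover have "lam (a (l p - 1)) < h p" by (rule blockD(2)[OF h p False])
        ultimately show ?thesis using pos[OF p False] p by simp
      qed
    qed (use h in \<open>auto simp: block_def PiE_def\<close>)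
    show "?f (?g k) = k" if k: "k \<in> PiE {1..r} ?M" for k
    proof (rule extensionalityI[of _ "{1..r}"])
      fix i assume i: "i \<in> {1..r}"
      have "k i \<in> ?M i" using k i by (auto simp: PiE_iff)
      then have "k i \<in> extensional (piece l i)" unfolding order_maps_iff Fld by blast
      then have "(\<lambda>p\<in>piece l i. nat (?g k p - lam (a (i - 1)))) = k i"
        by (intro extensionalityI[of _ "piece l i"]) (auto simp: piece_def)
      then show "?f (?g k) i = k i" using i by simp
    qed (use k in \<open>auto simp: PiE_def\<close>)
  qed
  moreover have "finite (PiE {1..r} ?M)"
    by (intro finite_PiE finite_order_maps finite_Field_Restr finite_Field) simp
  ultimately show "finite (block lam l)" and "card (block lam l) = (\<Prod>i=1..r. card (?M i))"
    by (simp_all add: bij_betw_finite bij_betw_same_card card_PiE)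
qed

lemma marked_order_count_eq:
  "of_nat (marked_order_count P A lam) =
    (\<Sum>l\<in>levelings. \<Prod>i=1..r. poly (order_poly (Restr P (piece l i))) (of_int (lam (a i) - lam (a (i - 1)))))"
proof -
  have "marked_order_count P A lam = card (\<Union>l\<in>levelings. block lam l)"
    by (simp only: marked_order_count_int[OF A_subset] extensions_eq_UN_block)
  also have "\<dots> = (\<Sum>l\<in>levelings. card (block lam l))"
  proof (rule card_UN_disjoint[OF finite_levelings])
    show "\<forall>l\<in>levelings. finite (block lam l)" using card_block(1) by blast
    show "\<forall>l\<in>levelings. \<forall>l'\<in>levelings. l \<noteq> l' \<longrightarrow> block lam l \<inter> block lam l' = {}"
    proof (intro ballI impI, rule ccontr)
      fix l l' assume l: "l \<in> levelings" "l' \<in> levelings" and "l \<noteq> l'"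
        and "block lam l \<inter> block lam l' \<noteq> {}"
      then obtain h where "h \<in> block lam l" "h \<in> block lam l'" by blast
      then have "l p = l' p" if "p \<in> Field P" for p
        using level_of_block l that by metis
      then have "l = l'"
        by (rule extensionalityI[OF levelingsD(4)[OF l(1)] levelingsD(4)[OF l(2)]])
      then show False using \<open>l \<noteq> l'\<close> by contradiction
    qed
  qed
  finally have "of_nat (marked_order_count P A lam) = (\<Sum>l\<in>levelings. \<Prod>i=1..r.
      (of_nat (card (order_maps (Restr P (piece l i)) (nat (lam (a i) - lam (a (i - 1)))))) :: rat))"
    by (simp add: card_block(2))
  also have "\<dots> = (\<Sum>l\<in>levelings. \<Prod>i=1..r.
      poly (order_poly (Restr P (piece l i))) (of_int (lam (a i) - lam (a (i - 1)))))"
  proof (intro sum.cong prod.cong refl)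
    \<comment> \<open>The differences are nonnegative, so \<open>nat\<close> is harmless; a
      difference of 0 is covered because the evaluation holds at 0 as well.\<close>
    fix l i assume "i \<in> {1..r}"
    then have "of_nat (nat (lam (a i) - lam (a (i - 1)))) = (of_int (lam (a i) - lam (a (i - 1))) :: rat)"
      using lam_step by simp
    then show "(of_nat (card (order_maps (Restr P (piece l i)) (nat (lam (a i) - lam (a (i - 1)))))) :: rat) =
        poly (order_poly (Restr P (piece l i))) (of_int (lam (a i) - lam (a (i - 1))))"
      using poly_order_poly_nat[OF finite_poset_Restr[OF poset], of "piece l i"] by metis
  qed
  finally show ?thesis .
qed

end

text \<open>A piece need not be an ideal or a filter of \<open>P\<close>. It is reached in two cuts:
  first the ideal \<open>?I\<close> of elements of level at most \<open>i\<close> not above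
  \<open>a i\<close>, then the top level of \<open>?I\<close>, which is a filter in it.\<close>

lemma Restr_piece_in_family:
  assumes "P \<in> F" and l: "l \<in> levelings" and "i \<le> r"
    and closed_ideals: "\<And>Q I. Q \<in> F \<Longrightarrow> order_ideal Q I \<Longrightarrow> Restr Q I \<in> F"
    and closed_filters: "\<And>Q I. Q \<in> F \<Longrightarrow> order_filter Q I \<Longrightarrow> Restr Q I \<in> F"
  shows "Restr P (piece l i) \<in> F"
proof -
  let ?I = "{p \<in> Field P. l p \<le> i \<and> (a i, p) \<notin> P}"
  have "order_ideal P ?I"
    using levelingsD(2)[OF l] P_trans by (fastforce simp: order_ideal_def FieldI1)
  then have "Restr P ?I \<in> F" using closed_ideals \<open>P \<in> F\<close> by blast
  moreover have "order_filter (Restr P ?I) (piece l i)"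
    using levelingsD(2)[OF l] Field_Restr_poset[OF poset, of ?I]
    by (fastforce simp: order_filter_def piece_def)
  ultimately have "Restr (Restr P ?I) (piece l i) \<in> F" by (rule closed_filters)
  moreover have "Restr (Restr P ?I) (piece l i) = Restr P (piece l i)" by (auto simp: piece_def)
  ultimately show ?thesis by simp
qed

end


section \<open>Polynomials with nonnegative coefficients\<close>

text \<open>Lets several polynomials be evaluated over one common set of exponent vectors, as
  additivity requires.\<close>

lemma eval_ratpoly_superset:
  assumes "finite S" "Poly_Mapping.keys f \<subseteq> S"
  shows "eval_ratpoly f t = (\<Sum>m\<in>S. Poly_Mapping.lookup f m *
    (\<Prod>i\<in>Poly_Mapping.keys m. t i ^ Poly_Mapping.lookup m i))"
  unfolding eval_ratpoly_def using assms
  by (intro sum.mono_neutral_left) (auto simp: in_keys_iff)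

lemma eval_ratpoly_sum:
  assumes "finite X"
  shows "eval_ratpoly (\<Sum>x\<in>X. f x) t = (\<Sum>x\<in>X. eval_ratpoly (f x) t)"
proof -
  let ?S = "\<Union>x\<in>X. Poly_Mapping.keys (f x)"
  let ?mon = "\<lambda>m. \<Prod>i\<in>Poly_Mapping.keys m. t i ^ Poly_Mapping.lookup m i"
  have "eval_ratpoly (\<Sum>x\<in>X. f x) t = (\<Sum>m\<in>?S. \<Sum>x\<in>X. Poly_Mapping.lookup (f x) m * ?mon m)"
    using assms keys_sum[of f X]
    by (subst eval_ratpoly_superset[of ?S]) (auto simp: lookup_sum sum_distrib_right)
  also have "\<dots> = (\<Sum>x\<in>X. \<Sum>m\<in>?S. Poly_Mapping.lookup (f x) m * ?mon m)" by (rule sum.swap)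
  also have "\<dots> = (\<Sum>x\<in>X. eval_ratpoly (f x) t)"
    using assms by (intro sum.cong refl eval_ratpoly_superset[symmetric]) auto
  finally show ?thesis .
qed

text \<open>Stated for the evaluated function, so that the argument needs sums and monomials but no
  product of \<open>ratpoly\<close> values.\<close>

definition nonneg_polynomial :: "nat set \<Rightarrow> ((nat \<Rightarrow> rat) \<Rightarrow> rat) \<Rightarrow> bool" where
  "nonneg_polynomial V g \<longleftrightarrow> (\<exists>f :: ratpoly. variables f \<subseteq> V \<and>
    (\<forall>m. Poly_Mapping.lookup f m \<ge> 0) \<and> (\<forall>t. eval_ratpoly f t = g t))"

lemma nonneg_polynomial_sum:
  assumes "finite X" "\<And>x. x \<in> X \<Longrightarrow> nonneg_polynomial V (g x)"
  shows "nonneg_polynomial V (\<lambda>t. \<Sum>x\<in>X. g x t)"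
proof -
  obtain f where f: "\<And>x. x \<in> X \<Longrightarrow> variables (f x) \<subseteq> V"
    "\<And>x m. x \<in> X \<Longrightarrow> Poly_Mapping.lookup (f x) m \<ge> 0"
    "\<And>x t. x \<in> X \<Longrightarrow> eval_ratpoly (f x) t = g x t"
    using assms(2) unfolding nonneg_polynomial_def by metis
  have "variables (\<Sum>x\<in>X. f x) \<subseteq> V"
    using keys_sum[of f X] f(1) by (fastforce simp: variables_def)
  then show ?thesis
    using f assms(1) unfolding nonneg_polynomial_def
    by (intro exI[of _ "\<Sum>x\<in>X. f x"]) (auto simp: lookup_sum eval_ratpoly_sum intro: sum_nonneg)
qed

lemma nonneg_polynomial_monomial:
  fixes c :: rat
  assumes "finite V" "c \<ge> 0"
  shows "nonneg_polynomial V (\<lambda>t. c * (\<Prod>i\<in>V. t i ^ k i))"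
proof -
  \<comment> \<open>The exponent vector: \<open>k\<close> cut off outside the finite set
    \<open>V\<close>, hence finitely supported.\<close>
  define m where "m = Abs_poly_mapping (\<lambda>i. k i when i \<in> V)"
  have lm: "Poly_Mapping.lookup m i = (k i when i \<in> V)" for i
  proof -
    have "finite {i. (k i when i \<in> V) \<noteq> 0}"
      by (rule finite_subset[OF _ assms(1)]) (auto simp: when_def split: if_splits)
    then show ?thesis by (simp add: m_def lookup_Abs_poly_mapping)
  qed
  have km: "Poly_Mapping.keys m \<subseteq> V" by (auto simp: in_keys_iff lm when_def split: if_splits)
  have "(\<Prod>i\<in>Poly_Mapping.keys m. t i ^ Poly_Mapping.lookup m i) = (\<Prod>i\<in>V. t i ^ k i)"
    for t :: "nat \<Rightarrow> rat"
  proof -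
    have "(\<Prod>i\<in>Poly_Mapping.keys m. t i ^ Poly_Mapping.lookup m i) =
        (\<Prod>i\<in>V. t i ^ Poly_Mapping.lookup m i)"
      using assms(1) km by (intro prod.mono_neutral_left) (auto simp: in_keys_iff)
    then show ?thesis by (simp add: lm)
  qed
  then have "eval_ratpoly (Poly_Mapping.single m c) t = c * (\<Prod>i\<in>V. t i ^ k i)" for t
    using eval_ratpoly_superset[of "{m}" "Poly_Mapping.single m c" t] by simp
  moreover have "variables (Poly_Mapping.single m c) \<subseteq> V"
    using km by (auto simp: variables_def)
  ultimately show ?thesis
    using assms(2) unfolding nonneg_polynomial_def
    by (intro exI[of _ "Poly_Mapping.single m c"]) (auto simp: lookup_single when_def)
qed

text \<open>Distributivity expands the product into one monomial for each choice \<open>k\<close> of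
  exponents, with a product of nonnegative coefficients in front.\<close>

lemma nonneg_polynomial_prod_poly:
  fixes p :: "nat \<Rightarrow> rat poly"
  assumes "finite V" "\<And>i k. i \<in> V \<Longrightarrow> coeff (p i) k \<ge> 0"
  shows "nonneg_polynomial V (\<lambda>t. \<Prod>i\<in>V. poly (p i) (t i))"
proof -
  have "(\<Prod>i\<in>V. poly (p i) (t i)) =
      (\<Sum>k\<in>PiE V (\<lambda>i. {..degree (p i)}). (\<Prod>i\<in>V. coeff (p i) (k i)) * (\<Prod>i\<in>V. t i ^ k i))" for t
    using assms(1) by (simp add: poly_altdef prod_sum_PiE prod.distrib)
  moreover have "nonneg_polynomial V
      (\<lambda>t. \<Sum>k\<in>PiE V (\<lambda>i. {..degree (p i)}). (\<Prod>i\<in>V. coeff (p i) (k i)) * (\<Prod>i\<in>V. t i ^ k i))"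
    using assms
    by (intro nonneg_polynomial_sum nonneg_polynomial_monomial finite_PiE prod_nonneg) auto
  ultimately show ?thesis by simp
qed


theorem theorem1p3:
  fixes F :: "'a rel set" and P :: "'a rel" and A :: "'a set"
    and r :: nat and a :: "nat \<Rightarrow> 'a"
  assumes posets: "\<And>Q. Q \<in> F \<Longrightarrow> finite_poset Q"
    and closed_ideals: "\<And>Q I. Q \<in> F \<Longrightarrow> order_ideal Q I \<Longrightarrow> Restr Q I \<in> F"
    and closed_filters: "\<And>Q I. Q \<in> F \<Longrightarrow> order_filter Q I \<Longrightarrow> Restr Q I \<in> F"
    and linear_term: "\<And>Q. Q \<in> F \<Longrightarrow> coeff (order_poly Q) 1 \<ge> 0"
    and "P \<in> F"
    and "A \<subseteq> Field P" and "min_elems P \<union> max_elems P \<subseteq> A"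
    and "natural_labeling P A r a"
  shows "\<exists>f :: ratpoly. variables f \<subseteq> {1..r} \<and> (\<forall>m. Poly_Mapping.lookup f m \<ge> 0) \<and>
    (\<forall>lam :: 'a \<Rightarrow> int. (\<forall>i\<in>{1..r}. lam (a (i - 1)) \<le> lam (a i)) \<longrightarrow>
       of_nat (marked_order_count P A lam) =
         eval_ratpoly f (\<lambda>i. of_int (lam (a i) - lam (a (i - 1)))))"
proof -
  interpret marked_poset P A r a
    using posets[OF \<open>P \<in> F\<close>] assms(6-8) by (rule marked_poset.intro)
  \<comment> \<open>No marking occurs in \<open>?g\<close>, so the polynomial representing it is
    chosen before \<open>lam\<close>.\<close>
  let ?g = "\<lambda>t. \<Sum>l\<in>levelings. \<Prod>i=1..r. poly (order_poly (Restr P (piece l i))) (t i)"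
  have "nonneg_polynomial {1..r} ?g"
  proof (intro nonneg_polynomial_sum nonneg_polynomial_prod_poly finite_levelings finite_atLeastAtMost)
    fix l i k assume "l \<in> levelings" "i \<in> {1..r}"
    then have R: "Restr P (piece l i) \<in> F"
      using Restr_piece_in_family[OF \<open>P \<in> F\<close> _ _ closed_ideals closed_filters] by simp
    show "coeff (order_poly (Restr P (piece l i))) k \<ge> 0"
      by (rule coeff_order_poly_nonneg[where F = F]) (fact posets closed_ideals closed_filters linear_term R)+
  qed
  then obtain f :: ratpoly where "variables f \<subseteq> {1..r}" "\<forall>m. Poly_Mapping.lookup f m \<ge> 0"
    and f: "\<And>t. eval_ratpoly f t = ?g t"
    unfolding nonneg_polynomial_def by blast
  then show ?thesis
    using marked_order_count_eq by (intro exI[of _ f]) (simp add: f)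
qed

end
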